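(* Let $\lambda$ be a nonzero real number, $p\ge-1$ an integer and $x\in\mathbb{R}$. For every integer $n\ge 0$, $$\beta_{n,\lambda}^{(p)}(x)=\sum_{k=0}^{n}\frac{(1)_{k+1,1/\lambda}\,\lambda^{k}}{\binom{p+k+1}{p+1}}\,S_{2,\lambda}(n,k|x).$$
   Context: For real $\mu$ and $x$: $(x)_{0,\mu}=1$ and $(x)_{n,\mu}=x(x-\mu)(x-2\mu)\cdots(x-(n-1)\mu)$ for $n\ge 1$; thus $(1)_{k+1,1/\lambda}$ is this symbol with $x=1$, $\mu=1/\lambda$. Also $\langle a\rangle_0=1$, $\langle a\rangle_k=a(a+1)\cdots(a+k-1)$ for $k\ge1$. The degenerate exponential is the formal power series $e_\lambda^x(t)=\sum_{n\ge0}(x)_{n,\lambda}\frac{t^n}{n!}$, with $e_\lambda(t)=e_\lambda^1(t)$. The degenerate Stirling polynomials of the second kind $S_{2,\lambda}(n,k|x)$ are defined, for $k\ge0$, by $\frac{1}{k!}(e_\lambda(t)-1)^k e_\lambda^x(t)=\sum_{n\ge k}S_{2,\lambda}(n,k|x)\frac{t^n}{n!}$. The Gauss hypergeometric series is ${}_2F_1(a,b;c;z)=\sum_{k\ge0}\frac{\langle a\rangle_k\langle b\rangle_k}{\langle c\rangle_k}\frac{z^k}{k!}$. For an integer $p\ge-1$, the generalized degenerate Bernoulli polynomials $\beta_{n,\lambda}^{(p)}(x)$ ($n\ge0$) are defined by the identity of formal power series in $t$ $${}_2F_1\big(1-\lambda,1;p+2;1-e_\lambda(t)\big)\,e_\lambda^x(t)=\sum_{n=0}^\infty\beta_{n,\lambda}^{(p)}(x)\frac{t^n}{n!}.$$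 *)

theory Defs
  imports Complex_Main "HOL-Computational_Algebra.Formal_Power_Series"
begin

text \<open>\<open>gen_falling \<mu> x n\<close> is \<open>(x)_{n,\<mu>} = x (x - \<mu>) ... (x - (n - 1) \<mu>)\<close>; note the argument order.\<close>

definition gen_falling :: "real \<Rightarrow> real \<Rightarrow> nat \<Rightarrow> real" where
  "gen_falling \<mu> x n = (\<Prod>i<n. x - real i * \<mu>)"

text \<open>\<open>deg_exp lam x\<close> is the formal power series \<open>e_\<lambda>^x(t)\<close>, with \<open>\<lambda>\<close> written \<open>lam\<close>, since
  \<open>\<lambda>\<close> is reserved for abstraction.\<close>

definition deg_exp :: "real \<Rightarrow> real \<Rightarrow> real fps" where
  "deg_exp lam x = Abs_fps (\<lambda>n. gen_falling lam x n / fact n)"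

lemma deg_exp_nth_0: "fps_nth (deg_exp lam x) 0 = 1"
  by (simp add: deg_exp_def gen_falling_def)

definition deg_stirling2_egf :: "real \<Rightarrow> nat \<Rightarrow> real \<Rightarrow> real fps" where
  "deg_stirling2_egf lam k x =
     fps_const (1 / fact k) * (deg_exp lam 1 - 1) ^ k * deg_exp lam x"

definition deg_stirling2 :: "real \<Rightarrow> nat \<Rightarrow> nat \<Rightarrow> real \<Rightarrow> real" where
  "deg_stirling2 lam n k x = fact n * fps_nth (deg_stirling2_egf lam k x) n"

text \<open>The generating series has no terms of order below \<open>k\<close>, so it is indeed a sum
  over \<open>n \<ge> k\<close>.\<close>

lemma deg_stirling2_eq_0:
  assumes "n < k"
  shows "deg_stirling2 lam n k x = 0"
proof -
  have "fps_nth (deg_exp lam 1 - 1) 0 = 0"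
    by (simp add: deg_exp_nth_0)
  then have "fps_nth ((deg_exp lam 1 - 1) ^ k) i = 0" if "i < k" for i
    using startsby_zero_power_prefix that by blast
  then have "fps_nth ((deg_exp lam 1 - 1) ^ k * deg_exp lam x) n = 0"
    using assms by (simp add: fps_mult_nth)
  then show ?thesis
    by (simp add: deg_stirling2_def deg_stirling2_egf_def mult.assoc)
qed

lemma deg_stirling2_gf:
  "deg_stirling2_egf lam k x = Abs_fps (\<lambda>n. if n < k then 0 else deg_stirling2 lam n k x / fact n)"
proof (rule fps_ext)
  fix n
  show "fps_nth (deg_stirling2_egf lam k x) n =
    fps_nth (Abs_fps (\<lambda>n. if n < k then 0 else deg_stirling2 lam n k x / fact n)) n"
    using deg_stirling2_eq_0[of n k lam x] by (simp add: deg_stirling2_def)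
qed

text \<open>Substituting \<open>1 - e_\<lambda>(t)\<close> into the Gauss series is the composition of formal power
  series, which is meaningful because \<open>1 - e_\<lambda>(t)\<close> has constant term \<open>0\<close>.
  For \<open>p \<ge> -1\<close> the lower parameter \<open>p + 2\<close> is positive, so no denominator vanishes.\<close>

definition gen_deg_bernoulli_egf :: "real \<Rightarrow> int \<Rightarrow> real \<Rightarrow> real fps" where
  "gen_deg_bernoulli_egf lam p x =
     (fps_hypergeo [1 - lam, 1] [of_int p + 2] 1 oo (1 - deg_exp lam 1)) * deg_exp lam x"

definition gen_deg_bernoulli :: "real \<Rightarrow> int \<Rightarrow> nat \<Rightarrow> real \<Rightarrow> real" where
  "gen_deg_bernoulli lam p n x = fact n * fps_nth (gen_deg_bernoulli_egf lam p x) n"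

lemma gen_deg_bernoulli_gf:
  "gen_deg_bernoulli_egf lam p x = Abs_fps (\<lambda>n. gen_deg_bernoulli lam p n x / fact n)"
  by (rule fps_ext) (simp add: gen_deg_bernoulli_def)

end

theory Submission
  imports Defs
begin

text \<open>Expand the hypergeometric series in powers of \<open>1 - deg_exp lam 1\<close> and
  compare coefficients term by term. Its coefficient at \<open>k\<close> is <1 - lam>_k / <p + 2>_k,
  and (1 - e)^k e^x equals (-1)^k k! times the generating series of the Stirling polynomials. The
  sign turns <1 - lam>_k into the degenerate falling factorial
  (\<open>gen_falling_eq_pochhammer\<close>), and k! / <p + 2>_k is a reciprocal binomial
  coefficient (\<open>pochhammer_of_nat_Suc\<close>). Only k \<le> n contribute
  (\<open>fps_compose_mult_nth\<close>).\<close>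

lemma fps_compose_mult_nth:
  fixes f g h :: "'a::comm_ring_1 fps"
  assumes "fps_nth g 0 = 0"
  shows "fps_nth ((f oo g) * h) n = (\<Sum>k=0..n. fps_nth f k * fps_nth (g ^ k * h) n)"
proof -
  \<comment> \<open>Since \<open>g ^ k\<close> has order at least \<open>k\<close>, the range of
    \<open>k\<close> can be made independent of \<open>i\<close>, which lets the two sums be
    swapped.\<close>
  have extend: "fps_nth (f oo g) i = (\<Sum>k=0..n. fps_nth f k * fps_nth (g ^ k) i)" if "i \<le> n" for i
    unfolding fps_compose_nth
  proof (rule sum.mono_neutral_left)
    show "\<forall>k\<in>{0..n} - {0..i}. fps_nth f k * fps_nth (g ^ k) i = 0"
      using startsby_zero_power_prefix[OF assms] by auto
  qed (use that in auto)
  have "fps_nth ((f oo g) * h) n =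
      (\<Sum>i=0..n. \<Sum>k=0..n. fps_nth f k * (fps_nth (g ^ k) i * fps_nth h (n - i)))"
    by (simp add: fps_mult_nth extend sum_distrib_right mult.assoc)
  also have "\<dots> = (\<Sum>k=0..n. fps_nth f k * fps_nth (g ^ k * h) n)"
    by (subst sum.swap) (simp add: fps_mult_nth sum_distrib_left)
  finally show ?thesis .
qed

text \<open>The factor of index 0 is 1; each of the \<open>k\<close> others, 1 - i/lam, absorbs one
  \<open>lam\<close> and becomes lam - i = -((1 - lam) + (i - 1)).\<close>

lemma gen_falling_eq_pochhammer:
  assumes "lam \<noteq> 0"
  shows "gen_falling (1 / lam) 1 (Suc k) * lam ^ k = (-1) ^ k * pochhammer (1 - lam) k"
proof (induction k)
  case 0
  then show ?case by (simp add: gen_falling_def)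
next
  case (Suc k)
  have "gen_falling (1 / lam) 1 (Suc (Suc k)) * lam ^ Suc k =
      (gen_falling (1 / lam) 1 (Suc k) * lam ^ k) * (lam - real (Suc k))"
    using assms by (simp add: gen_falling_def field_simps)
  also have "\<dots> = (-1) ^ Suc k * pochhammer (1 - lam) (Suc k)"
    unfolding Suc.IH by (simp add: pochhammer_Suc algebra_simps)
  finally show ?case .
qed

text \<open>Used with m = p + 1 for the lower parameter p + 2; both sides are (m + k)! / m!.\<close>

lemma pochhammer_of_nat_Suc:
  "pochhammer (of_nat (Suc m) :: 'a::field_char_0) k = fact k * of_nat ((m + k) choose m)"
proof -
  have "pochhammer (of_nat (Suc m) :: 'a) k = fact (m + k) / fact m"
    using pochhammer_product'[of "1 :: 'a" m k] by (simp add: field_simps flip: pochhammer_fact)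
  also have "\<dots> = fact k * of_nat ((m + k) choose m)"
    by (simp add: binomial_fact)
  finally show ?thesis .
qed

theorem theorem10:
  fixes lam x :: real and p :: int and n :: nat
  assumes "lam \<noteq> 0" and "p \<ge> -1"
  shows "gen_deg_bernoulli lam p n x =
    (\<Sum>k=0..n. gen_falling (1 / lam) 1 (k + 1) * lam ^ k
       / real (nat (p + int k + 1) choose nat (p + 1)) * deg_stirling2 lam n k x)"
proof -
  define m where "m = nat (p + 1)"
  have p: "p = int m - 1"
    using assms(2) by (simp add: m_def)
  define E where "E = deg_exp lam 1 - 1"
  have term_eq: "fact n * (fps_nth (fps_hypergeo [1 - lam, 1] [of_int p + 2] 1) k *
        fps_nth ((1 - deg_exp lam 1) ^ k * deg_exp lam x) n) =
      gen_falling (1 / lam) 1 (k + 1) * lam ^ k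
       / real (nat (p + int k + 1) choose nat (p + 1)) * deg_stirling2 lam n k x" for k
  proof -
    \<comment> \<open>The upper parameter 1 contributes <1>_k = k!, cancelling the k! in the
      denominator of the series.\<close>
    have "fps_nth (fps_hypergeo [1 - lam, 1] [of_int p + 2] 1) k =
        pochhammer (1 - lam) k / pochhammer (of_nat (Suc m) :: real) k"
      by (simp add: pochhammer_fact[symmetric] p add_ac)
    moreover have "fps_nth ((1 - deg_exp lam 1) ^ k * deg_exp lam x) n =
        (-1) ^ k * fps_nth (E ^ k * deg_exp lam x) n"
    proof -
      have "1 - deg_exp lam 1 = fps_const (- 1) * E"
        by (simp add: E_def flip: fps_const_neg)
      then show ?thesis
        by (simp only: power_mult_distrib fps_const_power mult.assoc fps_mult_left_const_nth)
    qed
    moreover have "nat (p + int k + 1) = m + k" "nat (p + 1) = m"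
      by (simp_all add: p nat_add_distrib)
    moreover have "deg_stirling2 lam n k x = fact n / fact k * fps_nth (E ^ k * deg_exp lam x) n"
      by (simp add: deg_stirling2_def deg_stirling2_egf_def E_def mult.assoc)
    ultimately show ?thesis
      using gen_falling_eq_pochhammer[OF assms(1), of k]
      by (simp add: pochhammer_of_nat_Suc mult_ac del: of_nat_Suc fps_hypergeo_nth)
  qed
  have "fps_nth (1 - deg_exp lam 1) 0 = 0"
    by (simp add: deg_exp_nth_0)
  then show ?thesis
    unfolding gen_deg_bernoulli_def gen_deg_bernoulli_egf_def
    by (simp only: fps_compose_mult_nth sum_distrib_left term_eq)
qed

end
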